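(* (Structure Theorem of Tropical Convexity.) Let $V=(v_{ij})$ be a $d\times n$-matrix with entries in $\mathbb R\cup\{\infty\}$ such that no column has all entries equal to $\infty$. The covector decomposition $\mathcal T(V)$ of $\mathbb R^d$ is dual to the regular subdivision of the polytope $$\operatorname{conv}\{(e_i,e_j)\in\mathbb R^d\times\mathbb R^n : (i,j)\in \mathrm B(V)\}$$ with weights given by $V$. Moreover, the covector decomposition of $\operatorname{tcone}(V)$ is dual to the poset of interior cells of this subdivision.
   Context: $\mathbb T_{\min}=\mathbb R\cup\{\infty\}$ with $\oplus=\min$, $\odot=+$. $\mathrm B(V)=\{(i,j)\in[d]\times[n] : v_{ij}\ne\infty\}$, viewed as a bipartite graph on the disjoint union of $[d]$ and $[n]$. $v^{(j)}$ denotes the $j$th column of $V$, and $e_i$ standard basis vectors. For $u\in\mathbb T_{\min}^d$ and $i$ with $u_i\neq\infty$ the $i$th sector is $S_i(u)=\{z\in\mathbb R^d : z_\ell-z_i\le u_\ell-u_i \text{ for all } \ell\in[d] \text{ with } u_\ell\ne\infty\}$. The sectors $S_i(u)$ with $u_i\ne\infty$ are the maximal cells of a polyhedral complex $\Delta(u)$ covering $\mathbb R^d$ (its cells are the intersections of nonempty families of these sectors). The covector decomposition $\mathcal T(V)$ is the common refinement of $\Delta(v^{(1)}),\dots,\Delta(v^{(n)})$; equivalently, its cells are the nonempty sets $X_G(V)=\bigcap_{(i,j)\in G}S_i(v^{(j)})$ where $G\subseteq \mathrm B(V)$ has no isolated node in $[n]$. $\operatorname{tcone}(V)=\{(\lambda_1\odot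 v^{(1)})\oplus\dots\oplus(\lambda_n\odot v^{(n)}) : \lambda_j\in\mathbb T_{\min}\}$; its covector decomposition consists of the cells of $\mathcal T(V)$ contained in $\operatorname{tcone}(V)$. The regular subdivision with weights $V$ is obtained by lifting each point $(e_i,e_j)$, $(i,j)\in \mathrm B(V)$, to height $v_{ij}$ and projecting the lower faces of the convex hull of the lifted points. To each cell of the subdivision belongs the graph $G\subseteq \mathrm B(V)$ of all pairs $(i,j)$ whose lifted point lies on the corresponding lower face. Meaning of "dual": there is an inclusion-reversing bijection between the cells of $\mathcal T(V)$ and those cells of the subdivision whose graph has no isolated node in $[n]$, under which the cell with graph $G$ corresponds to $X_G(V)$. A cell of the subdivision is "interior" if it is not contained in the boundary of the product of simplices $\Delta_{d-1}\times\Delta_{n-1}=\operatorname{conv}\{(e_i,e_j): (i,j)\in[d]\times[n]\}$, i.e. if its graph has no isolated node in $[d]$ or in $[n]$; the second statement asserts that the bijection restricts to one between the cells of $\mathcal T(V)$ contained in $\operatorname{tcone}(V)$ and the interior cells. *)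

theory Defs
  imports "HOL-Analysis.Analysis"
begin

subsection \<open>Tropical matrices and the covector decomposition\<close>

text \<open>
  The min-plus semiring is the set of all \<^term>\<open>x :: ereal\<close> with \<^term>\<open>x \<noteq> -\<infinity>\<close>, with \<^const>\<open>min\<close>
  as tropical addition and \<open>+\<close> as tropical multiplication.
  A \<open>d \<times> n\<close> matrix has type \<^typ>\<open>ereal^'n^'d\<close>; its entries are required to differ from
  \<^term>\<open>-\<infinity> :: ereal\<close> wherever this matters.
\<close>

definition finite_entries :: "ereal^'n^'d \<Rightarrow> ('d \<times> 'n) set" where
  "finite_entries V = {(i, j). V $ i $ j \<noteq> \<infinity>}"

definition sector :: "ereal^'d \<Rightarrow> 'd \<Rightarrow> (real^'d) set" where
  "sector u i = {z. \<forall>l. u $ l \<noteq> \<infinity> \<longrightarrow> ereal (z $ l - z $ i) \<le> u $ l - u $ i}"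

definition sector_complex :: "ereal^'d \<Rightarrow> (real^'d) set set" where
  "sector_complex u = {(\<Inter>i\<in>I. sector u i) | I. I \<noteq> {} \<and> I \<subseteq> {i. u $ i \<noteq> \<infinity>}}"

text \<open>The common refinement of the sector complexes of all columns.\<close>

definition covector_decomposition :: "ereal^'n^'d \<Rightarrow> (real^'d) set set" where
  "covector_decomposition V =
     {(\<Inter>j. C j) | C. (\<forall>j. C j \<in> sector_complex (column j V)) \<and> (\<Inter>j. C j) \<noteq> {}}"

definition covector_cell :: "ereal^'n^'d \<Rightarrow> ('d \<times> 'n) set \<Rightarrow> (real^'d) set" where
  "covector_cell V G = (\<Inter>(i, j)\<in>G. sector (column j V) i)"

definition tcone :: "ereal^'n^'d \<Rightarrow> (ereal^'d) set" where
  "tcone V = {(\<chi> i. MIN j. c j + V $ i $ j) | c. \<forall>j. c j \<noteq> -\<infinity>}"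

definition tcone_covector_decomposition :: "ereal^'n^'d \<Rightarrow> (real^'d) set set" where
  "tcone_covector_decomposition V =
     {A \<in> covector_decomposition V. \<forall>z\<in>A. (\<chi> i. ereal (z $ i)) \<in> tcone V}"


subsection \<open>Regular subdivisions of point configurations\<close>

text \<open>A point configuration \<open>p\<close>, indexed by \<open>K\<close>, with height function \<open>w\<close>.\<close>

definition lifted_polytope ::
    "('k \<Rightarrow> 'a::euclidean_space) \<Rightarrow> ('k \<Rightarrow> real) \<Rightarrow> 'k set \<Rightarrow> ('a \<times> real) set" where
  "lifted_polytope p w K = convex hull ((\<lambda>k. (p k, w k)) ` K)"

text \<open>The nonempty faces that have an inner normal vector with positive last coordinate.\<close>

definition lower_faces :: "('a::euclidean_space \<times> real) set \<Rightarrow> ('a \<times> real) set set" where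
  "lower_faces P =
     {F. F \<noteq> {} \<and> (\<exists>a h b. h > 0 \<and> P \<subseteq> {x. (a, h) \<bullet> x \<ge> b} \<and> F = P \<inter> {x. (a, h) \<bullet> x = b})}"

definition regular_subdivision ::
    "('k \<Rightarrow> 'a::euclidean_space) \<Rightarrow> ('k \<Rightarrow> real) \<Rightarrow> 'k set \<Rightarrow> 'a set set" where
  "regular_subdivision p w K = (\<lambda>F. fst ` F) ` lower_faces (lifted_polytope p w K)"

text \<open>A lower face is determined by its projection, so the description below is proper.\<close>

lemma inj_on_lower_faces: "inj_on (\<lambda>F. fst ` F) (lower_faces P)"
proof -
  have sub: "F \<subseteq> F'"
    if F: "F \<in> lower_faces P" and F': "F' \<in> lower_faces P" and eq: "fst ` F = fst ` F'" for F F'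
  proof
    fix y assume y: "y \<in> F"
    obtain x t where xt: "y = (x, t)" by (cases y)
    from y xt eq have "x \<in> fst ` F'" by force
    then obtain t' where t': "(x, t') \<in> F'" by force
    obtain a h b where 1: "h > 0" "P \<subseteq> {x. (a, h) \<bullet> x \<ge> b}" "F = P \<inter> {x. (a, h) \<bullet> x = b}"
      using F unfolding lower_faces_def by blast
    obtain a' h' b' where 2: "h' > 0" "P \<subseteq> {x. (a', h') \<bullet> x \<ge> b'}" "F' = P \<inter> {x. (a', h') \<bullet> x = b'}"
      using F' unfolding lower_faces_def by blast
    have P: "(x, t) \<in> P" "(x, t') \<in> P" using y xt t' 1 2 by auto
    have "a \<bullet> x + h * t = b" "a \<bullet> x + h * t' \<ge> b" using y xt 1 P by auto
    then have "h * t \<le> h * t'" by linarith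
    then have "t \<le> t'" using 1(1) by simp
    moreover have "a' \<bullet> x + h' * t' = b'" "a' \<bullet> x + h' * t \<ge> b'" using t' 2 P by auto
    then have "h' * t' \<le> h' * t" by linarith
    then have "t' \<le> t" using 2(1) by simp
    ultimately show "y \<in> F'" using t' xt by simp
  qed
  show ?thesis
    by (rule inj_onI, rule subset_antisym) (rule sub; simp)+
qed

definition lower_face_over ::
    "('k \<Rightarrow> 'a::euclidean_space) \<Rightarrow> ('k \<Rightarrow> real) \<Rightarrow> 'k set \<Rightarrow> 'a set \<Rightarrow> ('a \<times> real) set" where
  "lower_face_over p w K C = (THE F. F \<in> lower_faces (lifted_polytope p w K) \<and> fst ` F = C)"

definition cell_indices ::
    "('k \<Rightarrow> 'a::euclidean_space) \<Rightarrow> ('k \<Rightarrow> real) \<Rightarrow> 'k set \<Rightarrow> 'a set \<Rightarrow> 'k set" where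
  "cell_indices p w K C = {k \<in> K. (p k, w k) \<in> lower_face_over p w K C}"


subsection \<open>The subdivision associated with a tropical matrix\<close>

definition vertex :: "'d \<times> 'n \<Rightarrow> (real^'d) \<times> (real^'n)" where
  "vertex = (\<lambda>(i, j). (axis i 1, axis j 1))"

definition weight :: "ereal^'n^'d \<Rightarrow> 'd \<times> 'n \<Rightarrow> real" where
  "weight V = (\<lambda>(i, j). real_of_ereal (V $ i $ j))"

definition matrix_subdivision :: "ereal^'n^'d \<Rightarrow> ((real^'d) \<times> (real^'n)) set set" where
  "matrix_subdivision V = regular_subdivision vertex (weight V) (finite_entries V)"

definition cell_graph :: "ereal^'n^'d \<Rightarrow> ((real^'d) \<times> (real^'n)) set \<Rightarrow> ('d \<times> 'n) set" where
  "cell_graph V C = cell_indices vertex (weight V) (finite_entries V) C"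

text \<open>The cells whose graph has no isolated node among the column indices.\<close>

definition column_covering_cells :: "ereal^'n^'d \<Rightarrow> ((real^'d) \<times> (real^'n)) set set" where
  "column_covering_cells V = {C \<in> matrix_subdivision V. \<forall>j. \<exists>i. (i, j) \<in> cell_graph V C}"

text \<open>
  The product of simplices lies in a proper affine subspace, so its boundary is the relative one.
\<close>

definition interior_cells :: "ereal^'n^'d \<Rightarrow> ((real^'d) \<times> (real^'n)) set set" where
  "interior_cells V =
     {C \<in> matrix_subdivision V. \<not> C \<subseteq> rel_frontier (convex hull (range vertex))}"

definition dual_via :: "('a set \<Rightarrow> 'b set) \<Rightarrow> 'a set set \<Rightarrow> 'b set set \<Rightarrow> bool" where
  "dual_via f \<C> \<D> \<longleftrightarrow>
     bij_betw f \<C> \<D> \<and> (\<forall>A\<in>\<C>. \<forall>B\<in>\<C>. A \<subseteq> B \<longleftrightarrow> f B \<subseteq> f A)"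

end

theory Submission
  imports Defs
begin

text \<open>
  A lower face is exposed by heights \<open>\<alpha>\<^sub>i + \<beta>\<^sub>j + v\<^sub>i\<^sub>j\<close> that attain their minimum exactly on its graph.
  If the graph meets column \<open>j\<close>, then with \<open>z = -\<alpha>\<close> the number \<open>\<beta>\<^sub>j\<close> is forced to be \<open>- (MIN i. v\<^sub>i\<^sub>j - z\<^sub>i)\<close>
  up to a constant, and \<open>(i, j)\<close> lies in the graph iff \<open>i\<close> attains this minimum, that is, iff \<open>z\<close>
  lies in the \<open>i\<close>-th sector of column \<open>j\<close>. So the graphs covering all columns are the covector
  graphs \<open>G(z)\<close> of points, and since \<open>y\<close> lies in the cell of \<open>G(z)\<close> iff \<open>G(z) \<subseteq> G(y)\<close>, inclusion
  of cells reverses inclusion of graphs. A point \<open>z\<close> lies in the tropical cone iff \<open>G(z)\<close> also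
  covers all rows, which for cells of the subdivision means being interior.
\<close>

subsection \<open>Cells of a regular subdivision\<close>

text \<open>The normal has a positive last coordinate, so moving straight down from a point of the
  face violates its supporting inequality.\<close>

lemma lower_face_below:
  assumes "F \<in> lower_faces P" "(x, t) \<in> F" "(x, t') \<in> P"
  shows "t \<le> t'"
proof -
  obtain a h b where 1: "h > 0" "P \<subseteq> {x. (a, h) \<bullet> x \<ge> b}" "F = P \<inter> {x. (a, h) \<bullet> x = b}"
    using assms(1) unfolding lower_faces_def by blast
  have "a \<bullet> x + h * t = b" "a \<bullet> x + h * t' \<ge> b" using assms(2,3) 1 by auto
  then have "h * t \<le> h * t'" by linarith
  then show ?thesis using 1(1) by simp
qed

text \<open>Removes the definite description in \<open>lower_face_over\<close>: by
  \<open>inj_on_lower_faces\<close>, any lower face with the given projection is that face.\<close>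

lemma cell_indices_fst_image:
  assumes "F \<in> lower_faces (lifted_polytope p w K)"
  shows "cell_indices p w K (fst ` F) = {k \<in> K. (p k, w k) \<in> F}"
proof -
  have "lower_face_over p w K (fst ` F) = F"
    unfolding lower_face_over_def
    using assms inj_onD[OF inj_on_lower_faces[of "lifted_polytope p w K"]]
    by (intro the_equality) simp_all
  then show ?thesis by (simp add: cell_indices_def)
qed

lemma lifted_point_in_lifted_polytope: "k \<in> K \<Longrightarrow> (p k, w k) \<in> lifted_polytope p w K"
  unfolding lifted_polytope_def by (simp add: hull_inc)

text \<open>A face of the hull of a finite set is the hull of the generators it contains.\<close>

lemma lower_face_eq_convex_hull:
  assumes "finite K" and F: "F \<in> lower_faces (lifted_polytope p w K)"
  shows "F = convex hull ((\<lambda>k. (p k, w k)) ` {k \<in> K. (p k, w k) \<in> F})"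
proof -
  let ?S = "(\<lambda>k. (p k, w k)) ` K"
  have img: "(\<lambda>k. (p k, w k)) ` {k \<in> K. (p k, w k) \<in> F} = ?S \<inter> F" by auto
  obtain a h b where 1: "lifted_polytope p w K \<subseteq> {x. (a, h) \<bullet> x \<ge> b}"
      "F = lifted_polytope p w K \<inter> {x. (a, h) \<bullet> x = b}"
    using F unfolding lower_faces_def by blast
  have face: "F face_of convex hull ?S"
    unfolding 1(2) lifted_polytope_def
    by (rule face_of_Int_supporting_hyperplane_ge[OF convex_convex_hull])
      (use 1(1) in \<open>auto simp: lifted_polytope_def\<close>)
  obtain S' where S': "S' \<subseteq> ?S" "F = convex hull S'"
    using face_of_convex_hull_subset[OF finite_imp_compact face] assms(1) by blast
  \<comment> \<open>\<open>S'\<close> may omit generators lying in \<open>F\<close>, for instance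
    ones that are not extreme; adding them does not change the hull.\<close>
  have "S' \<subseteq> ?S \<inter> F" using S' hull_subset[of S' convex] by blast
  then have "F \<subseteq> convex hull (?S \<inter> F)" using S' hull_mono by metis
  moreover have "convex hull (?S \<inter> F) \<subseteq> F"
    by (rule hull_minimal) (use face_of_imp_convex[OF face] in blast)+
  ultimately show ?thesis unfolding img by (rule subset_antisym)
qed

lemma cell_eq_convex_hull:
  assumes "finite K" "C \<in> regular_subdivision p w K"
  shows "C = convex hull (p ` cell_indices p w K C)"
proof -
  obtain F where F: "F \<in> lower_faces (lifted_polytope p w K)" "C = fst ` F"
    using assms(2) unfolding regular_subdivision_def by auto
  let ?G = "{k \<in> K. (p k, w k) \<in> F}"
  have "fst ` F = fst ` (convex hull ((\<lambda>k. (p k, w k)) ` ?G))"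
    using lower_face_eq_convex_hull[OF assms(1) F(1)] by simp
  also have "\<dots> = convex hull (fst ` (\<lambda>k. (p k, w k)) ` ?G)"
    by (rule convex_hull_linear_image) (rule linear_fst)
  also have "fst ` (\<lambda>k. (p k, w k)) ` ?G = p ` ?G" by (simp add: image_image)
  finally show ?thesis using cell_indices_fst_image[OF F(1)] F(2) by simp
qed

text \<open>From graphs to cells, this is monotonicity of hulls. The other direction holds because
  every lower face has the least height of the lifted polytope over each of its base points, so two
  of them agree wherever their projections meet.\<close>

lemma cell_subset_iff:
  assumes "finite K" "C \<in> regular_subdivision p w K" "D \<in> regular_subdivision p w K"
  shows "C \<subseteq> D \<longleftrightarrow> cell_indices p w K C \<subseteq> cell_indices p w K D"
proof
  assume "cell_indices p w K C \<subseteq> cell_indices p w K D"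
  then show "C \<subseteq> D"
    using cell_eq_convex_hull[OF assms(1,2)] cell_eq_convex_hull[OF assms(1,3)]
    by (metis hull_mono image_mono)
next
  assume sub: "C \<subseteq> D"
  obtain F where F: "F \<in> lower_faces (lifted_polytope p w K)" "C = fst ` F"
    using assms(2) unfolding regular_subdivision_def by auto
  obtain F' where F': "F' \<in> lower_faces (lifted_polytope p w K)" "D = fst ` F'"
    using assms(3) unfolding regular_subdivision_def by auto
  have FP: "F' \<subseteq> lifted_polytope p w K" using F'(1) unfolding lower_faces_def by blast
  \<comment> \<open>A priori \<open>F'\<close> contains some lift \<open>t\<close> of
    \<open>p k\<close>; least height in both faces forces \<open>t = w k\<close>.\<close>
  have "(p k, w k) \<in> F'" if k: "k \<in> K" "(p k, w k) \<in> F" for k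
  proof -
    have "p k \<in> fst ` F'" using sub k F(2) F'(2) by force
    then obtain t where t: "(p k, t) \<in> F'" by force
    have "t \<le> w k"
      using lower_face_below[OF F'(1) t] lifted_point_in_lifted_polytope k(1) by metis
    moreover have "w k \<le> t" using lower_face_below[OF F(1) k(2)] t FP by blast
    ultimately show ?thesis using t by simp
  qed
  then show "cell_indices p w K C \<subseteq> cell_indices p w K D"
    using cell_indices_fst_image[OF F(1)] cell_indices_fst_image[OF F'(1)] F(2) F'(2) by auto
qed

text \<open>Dividing the normal by its positive last coordinate turns a lower face into the
  minimizers of a linear functional plus the weight. With its converse \<open>exposed_cell\<close>,
  this replaces polytopes by inequalities on indices.\<close>

lemma cell_indices_exposed:
  assumes "finite K" "C \<in> regular_subdivision p w K"
  obtains a b where "\<And>k. k \<in> K \<Longrightarrow> a \<bullet> p k + w k \<ge> b"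
    "cell_indices p w K C = {k \<in> K. a \<bullet> p k + w k = b}" "cell_indices p w K C \<noteq> {}"
proof -
  obtain F where F: "F \<in> lower_faces (lifted_polytope p w K)" "C = fst ` F"
    using assms(2) unfolding regular_subdivision_def by auto
  obtain a h b where 1: "h > 0" "lifted_polytope p w K \<subseteq> {x. (a, h) \<bullet> x \<ge> b}"
      "F = lifted_polytope p w K \<inter> {x. (a, h) \<bullet> x = b}" and "F \<noteq> {}"
    using F(1) unfolding lower_faces_def by blast
  have G: "cell_indices p w K C = {k \<in> K. (p k, w k) \<in> F}"
    using cell_indices_fst_image[OF F(1)] F(2) by simp
  have *: "(a /\<^sub>R h) \<bullet> p k + w k = ((a, h) \<bullet> (p k, w k)) / h" for k
    using 1(1) by (simp add: field_simps)
  show ?thesis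
  proof (rule that)
    show "(a /\<^sub>R h) \<bullet> p k + w k \<ge> b / h" if "k \<in> K" for k
    proof -
      have "(a, h) \<bullet> (p k, w k) \<ge> b"
        using lifted_point_in_lifted_polytope[OF that, of p w] 1(2) by blast
      then show ?thesis unfolding * using 1(1) by (simp add: divide_right_mono)
    qed
    show "cell_indices p w K C = {k \<in> K. (a /\<^sub>R h) \<bullet> p k + w k = b / h}"
      unfolding G 1(3) * using 1(1) lifted_point_in_lifted_polytope[of _ K p w] by auto
    show "cell_indices p w K C \<noteq> {}"
      using lower_face_eq_convex_hull[OF assms(1) F(1)] \<open>F \<noteq> {}\<close> unfolding G
      by (metis convex_hull_empty image_empty)
  qed
qed

lemma exposed_cell:
  assumes low: "\<And>k. k \<in> K \<Longrightarrow> a \<bullet> p k + w k \<ge> b"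
    and ne: "{k \<in> K. a \<bullet> p k + w k = b} \<noteq> {}"
  obtains C where "C \<in> regular_subdivision p w K"
    "cell_indices p w K C = {k \<in> K. a \<bullet> p k + w k = b}"
proof -
  let ?P = "lifted_polytope p w K"
  let ?F = "?P \<inter> {x. (a, 1) \<bullet> x = b}"
  have "?P \<subseteq> {x. (a, 1) \<bullet> x \<ge> b}"
    unfolding lifted_polytope_def
    by (rule hull_minimal) (use low in \<open>auto simp: convex_halfspace_ge\<close>)
  moreover have "?F \<noteq> {}" using ne lifted_point_in_lifted_polytope[of _ K p w] by fastforce
  ultimately have F: "?F \<in> lower_faces ?P"
    unfolding lower_faces_def mem_Collect_eq using zero_less_one by blast
  have "fst ` ?F \<in> regular_subdivision p w K"
    using F unfolding regular_subdivision_def by blast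
  moreover have "cell_indices p w K (fst ` ?F) = {k \<in> K. a \<bullet> p k + w k = b}"
    unfolding cell_indices_fst_image[OF F]
    using lifted_point_in_lifted_polytope[of _ K p w] by auto
  ultimately show ?thesis by (rule that)
qed


subsection \<open>Interior cells\<close>

text \<open>The axis vectors are affinely independent, and the barycentric coordinates of a point
  with respect to them are its entries.\<close>

lemma rel_interior_convex_hull_axes:
  "x \<in> rel_interior (convex hull (range (\<lambda>i. axis i 1 :: real^'d)))
     \<longleftrightarrow> (\<forall>i. x $ i > 0) \<and> (\<Sum>i\<in>UNIV. x $ i) = 1"
proof -
  have inj: "inj (\<lambda>i. axis i 1 :: real^'d)" by (auto simp: inj_on_def axis_eq_axis)
  have "range (\<lambda>i. axis i 1 :: real^'d) \<subseteq> Basis" by (auto simp: Basis_vec_def)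
  then have "independent (range (\<lambda>i. axis i 1 :: real^'d))"
    using independent_Basis independent_mono by blast
  then have aff: "\<not> affine_dependent (range (\<lambda>i. axis i 1 :: real^'d))"
    using affine_dependent_imp_dependent by blast
  have sum: "(\<Sum>i\<in>UNIV. f i *\<^sub>R (axis i 1 :: real^'d)) = (\<chi> i. f i)" for f
    by (auto simp: vec_eq_iff axis_def if_distrib sum.delta cong: if_cong)
  show ?thesis
    unfolding rel_interior_convex_hull_explicit[OF aff]
  proof safe
    fix u :: "real^'d \<Rightarrow> real" and i :: 'd
    assume u: "\<forall>x\<in>range (\<lambda>i. axis i 1). 0 < u x" "sum u (range (\<lambda>i. axis i 1)) = 1"
    show "(\<Sum>x\<in>range (\<lambda>i. axis i 1). u x *\<^sub>R x) $ i > 0"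
      using u by (simp add: sum.reindex[OF inj] sum)
    show "(\<Sum>i\<in>UNIV. (\<Sum>x\<in>range (\<lambda>i. axis i 1). u x *\<^sub>R x) $ i) = 1"
      using u by (simp add: sum.reindex[OF inj] sum o_def)
  next
    assume x: "\<forall>i. x $ i > 0" "(\<Sum>i\<in>UNIV. x $ i) = 1"
    \<comment> \<open>The coefficients are indexed by vectors, so each axis vector is first mapped
      back to its index.\<close>
    let ?u = "\<lambda>y::real^'d. x $ (inv (\<lambda>i. axis i 1) y)"
    have u: "?u (axis i 1) = x $ i" for i by (simp add: inv_f_f[OF inj])
    show "\<exists>u. (\<forall>x\<in>range (\<lambda>i. axis i 1). 0 < u x) \<and> sum u (range (\<lambda>i. axis i 1)) = 1 \<and>
        (\<Sum>x\<in>range (\<lambda>i. axis i 1). u x *\<^sub>R x) = x"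
      by (rule exI[of _ ?u])
        (use x in \<open>simp add: sum.reindex[OF inj] o_def u sum vec_lambda_eta\<close>)
  qed
qed

lemma convex_hull_vertices:
  "convex hull (range (vertex :: 'd::finite \<times> 'n::finite \<Rightarrow> _)) =
     (convex hull (range (\<lambda>i. axis i 1 :: real^'d))) \<times> (convex hull (range (\<lambda>j. axis j 1 :: real^'n)))"
proof -
  have "range (vertex :: 'd \<times> 'n \<Rightarrow> _) =
      range (\<lambda>i. axis i 1 :: real^'d) \<times> range (\<lambda>j. axis j 1 :: real^'n)"
    by (auto simp: vertex_def image_def)
  then show ?thesis by (simp add: convex_hull_Times)
qed

text \<open>If a row or column is missed, the corresponding coordinate vanishes on the hull and cuts
  out a proper face of the product. If none is missed, the centroid of the vertices has only
  positive coordinates and so is a relative interior point.\<close>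

lemma convex_hull_vertices_subset_rel_frontier_iff:
  fixes G :: "('d::finite \<times> 'n::finite) set"
  assumes "G \<noteq> {}"
  shows "convex hull (vertex ` G) \<subseteq> rel_frontier (convex hull (range vertex)) \<longleftrightarrow>
     \<not> ((\<forall>i. \<exists>j. (i, j) \<in> G) \<and> (\<forall>j. \<exists>i. (i, j) \<in> G))"
proof -
  let ?D = "convex hull (range (vertex :: 'd \<times> 'n \<Rightarrow> _))"
  have frontier: "convex hull (vertex ` G) \<subseteq> rel_frontier ?D"
    if a: "\<And>k. a \<bullet> vertex k \<ge> 0" and G: "\<And>k. k \<in> G \<Longrightarrow> a \<bullet> vertex k = 0"
      and l: "a \<bullet> vertex l \<noteq> 0" for a and l :: "'d \<times> 'n"
  proof -
    have ge: "?D \<subseteq> {x. a \<bullet> x \<ge> 0}"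
      by (rule hull_minimal) (use a in \<open>auto simp: convex_halfspace_ge\<close>)
    then have face: "?D \<inter> {x. a \<bullet> x = 0} face_of ?D"
      by (intro face_of_Int_supporting_hyperplane_ge convex_convex_hull) auto
    have "vertex l \<in> ?D" by (simp add: hull_inc)
    then have "?D \<inter> {x. a \<bullet> x = 0} \<noteq> ?D" using l by blast
    then have "?D \<inter> {x. a \<bullet> x = 0} \<subseteq> rel_frontier ?D"
      using face face_of_subset_rel_frontier by blast
    moreover have "convex hull (vertex ` G) \<subseteq> ?D \<inter> {x. a \<bullet> x = 0}"
      by (rule hull_minimal)
        (use G in \<open>auto simp: hull_inc intro!: convex_Int convex_hyperplane\<close>)
    ultimately show ?thesis by blast
  qed
  have "convex hull (vertex ` G) \<subseteq> rel_frontier ?D" if i: "\<And>j. (i, j) \<notin> G" for i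
    \<comment> \<open>Any column serves for \<open>undefined\<close>: the coordinate of row
      \<open>i\<close> equals 1 at every vertex of that row.\<close>
    by (rule frontier[where a = "(axis i 1, 0)" and l = "(i, undefined)"])
      (use i in \<open>auto simp: vertex_def inner_axis_axis\<close>)
  moreover have "convex hull (vertex ` G) \<subseteq> rel_frontier ?D" if j: "\<And>i. (i, j) \<notin> G" for j
    by (rule frontier[where a = "(0, axis j 1)" and l = "(undefined, j)"])
      (use j in \<open>auto simp: vertex_def inner_axis_axis\<close>)
  moreover have "\<not> convex hull (vertex ` G) \<subseteq> rel_frontier ?D"
    if cov: "\<forall>i. \<exists>j. (i, j) \<in> G" "\<forall>j. \<exists>i. (i, j) \<in> G"
  proof -
    define x where "x = (\<Sum>k\<in>G. (1 / card G) *\<^sub>R vertex k)"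
    have card: "card G > 0" using assms by (simp add: card_gt_0_iff)
    have x: "x \<in> convex hull (vertex ` G)"
      unfolding x_def
      by (rule convex_sum) (use card in \<open>auto simp: hull_inc\<close>)
    have fst: "fst x $ i = (\<Sum>k\<in>G. (1 / card G) * of_bool (fst k = i))" for i
      unfolding x_def
      by (auto simp: fst_sum vertex_def split_def axis_def intro!: sum.cong)
    have snd: "snd x $ j = (\<Sum>k\<in>G. (1 / card G) * of_bool (snd k = j))" for j
      unfolding x_def
      by (auto simp: snd_sum vertex_def split_def axis_def intro!: sum.cong)
    have "fst x $ i > 0" for i
    proof -
      obtain j where "(i, j) \<in> G" using cov by blast
      then show ?thesis unfolding fst using card
        by (intro sum_pos2[where i = "(i, j)"]) auto
    qed
    moreover have "snd x $ j > 0" for j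
    proof -
      obtain i where "(i, j) \<in> G" using cov by blast
      then show ?thesis unfolding snd using card
        by (intro sum_pos2[where i = "(i, j)"]) auto
    qed
    moreover have "(\<Sum>i\<in>UNIV. fst x $ i) = 1"
      unfolding fst using card
      \<comment> \<open>After swapping, each edge of \<open>G\<close> contributes to exactly one
        row, so the total is \<open>card G\<close> times \<open>1 / card G\<close>.\<close>
      by (subst sum.swap) (simp add: of_bool_def assms flip: sum_divide_distrib)
    moreover have "(\<Sum>i\<in>UNIV. snd x $ i) = 1"
      unfolding snd using card
      by (subst sum.swap) (simp add: of_bool_def assms flip: sum_divide_distrib)
    ultimately have "x \<in> rel_interior ?D"
      unfolding convex_hull_vertices
      by (simp add: rel_interior_Times rel_interior_convex_hull_axes mem_Times_iff)
    then have "x \<notin> rel_frontier ?D" by (simp add: rel_frontier_def)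
    then show ?thesis using x by blast
  qed
  ultimately show ?thesis by blast
qed


subsection \<open>Covectors\<close>

text \<open>The covector of \<open>z\<close>: the largest set of finite positions whose cell
  contains \<open>z\<close>.\<close>

definition covector_graph :: "ereal^'n^'d \<Rightarrow> real^'d \<Rightarrow> ('d \<times> 'n) set" where
  "covector_graph V z = {(i, j) \<in> finite_entries V. z \<in> sector (column j V) i}"

lemma covector_graph_subset: "covector_graph V z \<subseteq> finite_entries V"
  by (auto simp: covector_graph_def)

lemma mem_covector_cell_iff:
  "G \<subseteq> finite_entries V \<Longrightarrow> z \<in> covector_cell V G \<longleftrightarrow> G \<subseteq> covector_graph V z"
  by (auto simp: covector_cell_def covector_graph_def)

text \<open>The point \<open>z\<close> lies in the cell of its own graph, so an inclusion of cells
  places it in the cell of \<open>y\<close>. Conversely, more edges mean more sectors to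
  intersect.\<close>

lemma covector_cell_subset_iff:
  "covector_cell V (covector_graph V z) \<subseteq> covector_cell V (covector_graph V y) \<longleftrightarrow>
     covector_graph V y \<subseteq> covector_graph V z"
proof
  assume "covector_cell V (covector_graph V z) \<subseteq> covector_cell V (covector_graph V y)"
  then have "z \<in> covector_cell V (covector_graph V y)"
    using mem_covector_cell_iff[OF covector_graph_subset] by blast
  then show "covector_graph V y \<subseteq> covector_graph V z"
    using mem_covector_cell_iff[OF covector_graph_subset] by blast
qed (auto simp: covector_cell_def)

section \<open>Covector graphs through column minima\<close>

context
  fixes V :: "ereal^('n::finite)^('d::finite)"
  assumes not_MInf: "\<And>i j. V $ i $ j \<noteq> -\<infinity>"
    and column_finite: "\<And>j. \<exists>i. V $ i $ j \<noteq> \<infinity>"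
begin

lemma ereal_weight: "(i, j) \<in> finite_entries V \<Longrightarrow> V $ i $ j = ereal (weight V (i, j))"
  using not_MInf[of i j] by (cases "V $ i $ j") (auto simp: finite_entries_def weight_def)

lemma mem_covector_graph_iff:
  "(i, j) \<in> covector_graph V z \<longleftrightarrow> (i, j) \<in> finite_entries V \<and>
     (\<forall>l. (l, j) \<in> finite_entries V \<longrightarrow> weight V (i, j) - z $ i \<le> weight V (l, j) - z $ l)"
proof -
  have "ereal (z $ l - z $ i) \<le> V $ l $ j - V $ i $ j \<longleftrightarrow>
      weight V (i, j) - z $ i \<le> weight V (l, j) - z $ l"
    if "(i, j) \<in> finite_entries V" "(l, j) \<in> finite_entries V" for l
    using that by (auto simp: ereal_weight)
  then show ?thesis
    by (auto simp: covector_graph_def sector_def column_def finite_entries_def)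
qed

text \<open>Its negative is the residual: the least coefficient \<open>c\<close> such that
  \<open>c\<close> times column \<open>j\<close>, tropically, is at least \<open>z\<close> in every
  row.\<close>

definition potential :: "real^'d \<Rightarrow> 'n \<Rightarrow> real" where
  "potential z j = Min ((\<lambda>l. weight V (l, j) - z $ l) ` {l. (l, j) \<in> finite_entries V})"

lemma potential_le: "(l, j) \<in> finite_entries V \<Longrightarrow> potential z j \<le> weight V (l, j) - z $ l"
  unfolding potential_def by (rule Min_le) auto

lemma potential_attained:
  obtains l where "(l, j) \<in> finite_entries V" "potential z j = weight V (l, j) - z $ l"
proof -
  have "{l. (l, j) \<in> finite_entries V} \<noteq> {}" using column_finite by (auto simp: finite_entries_def)
  then have "potential z j \<in> (\<lambda>l. weight V (l, j) - z $ l) ` {l. (l, j) \<in> finite_entries V}"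
    unfolding potential_def by (intro Min_in) auto
  then show ?thesis using that by auto
qed

lemma covector_graph_eq_potential:
  "covector_graph V z = {(i, j) \<in> finite_entries V. weight V (i, j) - z $ i = potential z j}"
proof -
  have "(i, j) \<in> covector_graph V z \<longleftrightarrow>
      (i, j) \<in> finite_entries V \<and> weight V (i, j) - z $ i = potential z j" for i j
    unfolding mem_covector_graph_iff
    by (metis potential_attained potential_le antisym)
  then show ?thesis by auto
qed

lemma covector_graph_covers_columns: "\<exists>i. (i, j) \<in> covector_graph V z"
proof -
  obtain l where "(l, j) \<in> finite_entries V" "potential z j = weight V (l, j) - z $ l"
    by (rule potential_attained)
  then show ?thesis unfolding covector_graph_eq_potential by auto
qed

text \<open>Fix a common minimizer \<open>l\<close> in column \<open>j\<close>. It stays a minimizer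
  at the midpoint, and the excess of row \<open>i\<close> over row \<open>l\<close> there is the
  mean of two nonnegative excesses, which vanishes only if both do.\<close>

lemma covector_graph_midpoint:
  assumes cov: "\<And>j. \<exists>i. (i, j) \<in> covector_graph V y \<inter> covector_graph V z"
  shows "covector_graph V ((1/2) *\<^sub>R (y + z)) = covector_graph V y \<inter> covector_graph V z"
proof -
  have "(i, j) \<in> covector_graph V ((1/2) *\<^sub>R (y + z)) \<longleftrightarrow>
      (i, j) \<in> covector_graph V y \<and> (i, j) \<in> covector_graph V z" for i j
  proof (cases "(i, j) \<in> finite_entries V")
    case fin: True
    obtain l where l: "(l, j) \<in> covector_graph V y" "(l, j) \<in> covector_graph V z"
      using cov by blast
    then have finl: "(l, j) \<in> finite_entries V" using covector_graph_subset by blast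
    \<comment> \<open>Once one minimizer is known, being a minimizer is a single comparison with
      it.\<close>
    have mem: "(i, j) \<in> covector_graph V x \<longleftrightarrow>
        weight V (i, j) - x $ i \<le> weight V (l, j) - x $ l"
      if "(l, j) \<in> covector_graph V x" for x
      using that fin finl unfolding mem_covector_graph_iff by (meson order_trans)
    have "(l, j) \<in> covector_graph V ((1/2) *\<^sub>R (y + z))"
      unfolding mem_covector_graph_iff
    proof (intro conjI allI impI finl)
      fix m assume "(m, j) \<in> finite_entries V"
      then have "weight V (l, j) - y $ l \<le> weight V (m, j) - y $ m"
        "weight V (l, j) - z $ l \<le> weight V (m, j) - z $ m"
        using l unfolding mem_covector_graph_iff by blast+
      then show "weight V (l, j) - ((1/2) *\<^sub>R (y + z)) $ l \<le> weight V (m, j) - ((1/2) *\<^sub>R (y + z)) $ m"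
        by (simp add: field_simps)
    qed
    moreover have "weight V (l, j) - y $ l \<le> weight V (i, j) - y $ i"
        "weight V (l, j) - z $ l \<le> weight V (i, j) - z $ i"
      using l fin unfolding mem_covector_graph_iff by blast+
    ultimately show ?thesis using mem l by (auto simp: field_simps)
  qed (use covector_graph_subset in blast)
  then show ?thesis by auto
qed

text \<open>
  A point of the cell with as small a covector graph as possible lies in the relative interior:
  passing to midpoints shrinks the graph unless it is already contained in all the others.
\<close>

lemma covector_cell_generic_point:
  assumes G: "G \<subseteq> finite_entries V" "\<And>j. \<exists>i. (i, j) \<in> G" and ne: "covector_cell V G \<noteq> {}"
  obtains z where "covector_cell V G = covector_cell V (covector_graph V z)"
proof -
  obtain z where z: "G \<subseteq> covector_graph V z"
    and min: "\<And>y. G \<subseteq> covector_graph V y \<Longrightarrow> card (covector_graph V z) \<le> card (covector_graph V y)"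
    using ne mem_covector_cell_iff[OF G(1)]
      ex_has_least_nat[where P = "\<lambda>y. G \<subseteq> covector_graph V y" and m = "\<lambda>y. card (covector_graph V y)"]
    by (metis all_not_in_conv)
  have "covector_graph V z \<subseteq> covector_graph V y" if y: "G \<subseteq> covector_graph V y" for y
  proof -
    have "covector_graph V ((1/2) *\<^sub>R (y + z)) = covector_graph V y \<inter> covector_graph V z"
      by (rule covector_graph_midpoint) (use y z G(2) in blast)
    then have "card (covector_graph V z) \<le> card (covector_graph V y \<inter> covector_graph V z)"
      using min[of "(1/2) *\<^sub>R (y + z)"] y z by simp
    then have "covector_graph V y \<inter> covector_graph V z = covector_graph V z"
      by (intro card_seteq) auto
    then show ?thesis by blast
  qed
  then have "y \<in> covector_cell V G \<longleftrightarrow> y \<in> covector_cell V (covector_graph V z)" for y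
    unfolding mem_covector_cell_iff[OF G(1)] mem_covector_cell_iff[OF covector_graph_subset]
    using z by blast
  then have "covector_cell V G = covector_cell V (covector_graph V z)" by blast
  then show ?thesis by (rule that)
qed

text \<open>Choosing a nonempty family of sectors for each column is choosing a graph that covers
  all columns; a generic point of its cell yields a covector graph with the same cell. Conversely,
  the columns of a covector graph give admissible families, and \<open>z\<close> shows that the
  intersection is nonempty.\<close>

lemma covector_decomposition_eq:
  "covector_decomposition V = range (\<lambda>z. covector_cell V (covector_graph V z))"
proof (intro equalityI subsetI)
  fix A assume "A \<in> covector_decomposition V"
  then obtain C where C: "\<And>j. C j \<in> sector_complex (column j V)" "A = (\<Inter>j. C j)" "A \<noteq> {}"
    unfolding covector_decomposition_def by auto
  then have "\<forall>j. \<exists>I. C j = (\<Inter>i\<in>I. sector (column j V) i) \<and> I \<noteq> {} \<and> I \<subseteq> {i. column j V $ i \<noteq> \<infinity>}"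
    unfolding sector_complex_def by blast
  then obtain I where I: "\<And>j. C j = (\<Inter>i\<in>I j. sector (column j V) i)" "\<And>j. I j \<noteq> {}"
      "\<And>j. I j \<subseteq> {i. column j V $ i \<noteq> \<infinity>}"
    by metis
  let ?G = "{(i, j). i \<in> I j}"
  have A: "A = covector_cell V ?G" unfolding C(2) I(1) covector_cell_def by auto
  have "?G \<subseteq> finite_entries V" using I(3) by (auto simp: finite_entries_def column_def)
  moreover have "\<exists>i. (i, j) \<in> ?G" for j using I(2)[of j] by auto
  ultimately show "A \<in> range (\<lambda>z. covector_cell V (covector_graph V z))"
    using covector_cell_generic_point A C(3) by (metis rangeI)
next
  fix A assume "A \<in> range (\<lambda>z. covector_cell V (covector_graph V z))"
  then obtain z where A: "A = covector_cell V (covector_graph V z)" by blast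
  let ?C = "\<lambda>j. \<Inter>i\<in>{i. (i, j) \<in> covector_graph V z}. sector (column j V) i"
  have "A = (\<Inter>j. ?C j)" unfolding A covector_cell_def by auto
  moreover have "z \<in> A" unfolding A by (simp add: mem_covector_cell_iff covector_graph_subset)
  moreover have "?C j \<in> sector_complex (column j V)" for j
    unfolding sector_complex_def mem_Collect_eq
    by (rule exI[of _ "{i. (i, j) \<in> covector_graph V z}"])
      (use covector_graph_covers_columns in \<open>auto simp: covector_graph_def finite_entries_def column_def\<close>)
  ultimately show "A \<in> covector_decomposition V"
    unfolding covector_decomposition_def mem_Collect_eq by (intro exI[of _ ?C]) blast
qed

text \<open>If \<open>z\<close> is a combination with coefficients \<open>c\<close>, a term
  attaining the minimum in row \<open>i\<close> is tight there and at least \<open>z\<close> in all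
  other rows, which puts its column into the graph. Conversely, the residual coefficients give terms
  that are at least \<open>z\<close>, with equality on the edges of the graph.\<close>

lemma mem_tcone_iff:
  "(\<chi> i. ereal (z $ i)) \<in> tcone V \<longleftrightarrow> (\<forall>i. \<exists>j. (i, j) \<in> covector_graph V z)"
proof
  assume "(\<chi> i. ereal (z $ i)) \<in> tcone V"
  then obtain c where c: "\<And>j. c j \<noteq> -\<infinity>" "\<And>i. ereal (z $ i) = (MIN j. c j + V $ i $ j)"
    unfolding tcone_def by (auto simp: vec_eq_iff)
  show "\<forall>i. \<exists>j. (i, j) \<in> covector_graph V z"
  proof
    fix i
    have "(MIN j. c j + V $ i $ j) \<in> range (\<lambda>j. c j + V $ i $ j)" by (rule Min_in) auto
    then obtain j where j: "ereal (z $ i) = c j + V $ i $ j" unfolding c(2)[symmetric] by blast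
    then have fin: "(i, j) \<in> finite_entries V" by (auto simp: finite_entries_def)
    \<comment> \<open>The sum is a real number, so its summand \<open>c j\<close> cannot be
      infinite.\<close>
    obtain r where r: "c j = ereal r" using j c(1)[of j] by (cases "c j") auto
    have zi: "z $ i = r + weight V (i, j)" using j r ereal_weight[OF fin] by simp
    have "weight V (i, j) - z $ i \<le> weight V (l, j) - z $ l" if "(l, j) \<in> finite_entries V" for l
    proof -
      have "ereal (z $ l) \<le> c j + V $ l $ j" unfolding c(2) by (rule Min_le) auto
      then have "z $ l \<le> r + weight V (l, j)" using r ereal_weight[OF that] by simp
      then show ?thesis using zi by simp
    qed
    then show "\<exists>j. (i, j) \<in> covector_graph V z" using fin mem_covector_graph_iff by blast
  qed
next
  assume cov: "\<forall>i. \<exists>j. (i, j) \<in> covector_graph V z"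
  have "ereal (z $ i) = (MIN j. ereal (- potential z j) + V $ i $ j)" for i
  proof (rule Min_eqI[symmetric])
    fix y assume "y \<in> range (\<lambda>j. ereal (- potential z j) + V $ i $ j)"
    then obtain j where y: "y = ereal (- potential z j) + V $ i $ j" by blast
    show "ereal (z $ i) \<le> y"
    proof (cases "(i, j) \<in> finite_entries V")
      case True
      then show ?thesis using potential_le[OF True, of z] by (simp add: y ereal_weight)
    qed (simp add: y finite_entries_def)
  next
    obtain j where j: "(i, j) \<in> covector_graph V z" using cov by blast
    then have "ereal (z $ i) = ereal (- potential z j) + V $ i $ j"
      by (auto simp: covector_graph_eq_potential ereal_weight)
    then show "ereal (z $ i) \<in> range (\<lambda>j. ereal (- potential z j) + V $ i $ j)" by blast
  qed simp
  then show "(\<chi> i. ereal (z $ i)) \<in> tcone V"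
    unfolding tcone_def mem_Collect_eq
    by (intro exI[of _ "\<lambda>j. ereal (- potential z j)"]) (simp add: vec_eq_iff)
qed

text \<open>Points of the cell have graphs containing that of \<open>z\<close>, so covering all rows
  passes from \<open>z\<close> to the whole cell; \<open>z\<close> itself gives the
  converse.\<close>

lemma covector_cell_in_tcone_decomposition_iff:
  "covector_cell V (covector_graph V z) \<in> tcone_covector_decomposition V \<longleftrightarrow>
     (\<forall>i. \<exists>j. (i, j) \<in> covector_graph V z)"
proof -
  have "covector_cell V (covector_graph V z) \<in> tcone_covector_decomposition V \<longleftrightarrow>
      (\<forall>y. covector_graph V z \<subseteq> covector_graph V y \<longrightarrow> (\<forall>i. \<exists>j. (i, j) \<in> covector_graph V y))"
    unfolding tcone_covector_decomposition_def covector_decomposition_eq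
    by (simp add: Ball_def mem_covector_cell_iff[OF covector_graph_subset] mem_tcone_iff)
  then show ?thesis by blast
qed

subsection \<open>Duality\<close>

lemma inner_vertex: "a \<bullet> vertex (i, j) = fst a $ i + snd a $ j"
  by (cases a) (simp add: vertex_def inner_axis)

lemma covector_graph_is_cell_graph:
  obtains C where "C \<in> matrix_subdivision V" "cell_graph V C = covector_graph V z"
proof -
  \<comment> \<open>Shifting rows by \<open>- z\<close> and columns by minus their minima makes all
    weights nonnegative, with zeros exactly on the covector graph.\<close>
  let ?a = "(- z, - (\<chi> j. potential z j))"
  have G: "{k \<in> finite_entries V. ?a \<bullet> vertex k + weight V k = 0} = covector_graph V z"
    by (auto simp: covector_graph_eq_potential inner_vertex)
  show ?thesis
  proof (rule exposed_cell[of "finite_entries V" 0 ?a vertex "weight V"])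
    show "?a \<bullet> vertex k + weight V k \<ge> 0" if "k \<in> finite_entries V" for k
      using that by (cases k) (use potential_le[of _ _ z] in \<open>fastforce simp: inner_vertex\<close>)
    show "{k \<in> finite_entries V. ?a \<bullet> vertex k + weight V k = 0} \<noteq> {}"
      unfolding G using covector_graph_covers_columns by blast
  qed (use G that in \<open>auto simp: matrix_subdivision_def cell_graph_def\<close>)
qed

lemma column_covering_cell_graph:
  assumes "C \<in> column_covering_cells V"
  obtains z where "cell_graph V C = covector_graph V z"
proof -
  have C: "C \<in> regular_subdivision vertex (weight V) (finite_entries V)"
    and cov: "\<And>j. \<exists>i. (i, j) \<in> cell_graph V C"
    using assms by (auto simp: column_covering_cells_def matrix_subdivision_def)
  obtain a b where low: "\<And>k. k \<in> finite_entries V \<Longrightarrow> a \<bullet> vertex k + weight V k \<ge> b"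
    and G: "cell_graph V C = {k \<in> finite_entries V. a \<bullet> vertex k + weight V k = b}"
    unfolding cell_graph_def by (rule cell_indices_exposed[OF finite_class.finite C]) blast
  let ?z = "- fst a"
  \<comment> \<open>Exposedness bounds every entry of column \<open>j\<close> from below by this
    value; an edge of the graph in that column attains the bound.\<close>
  have pot: "potential ?z j = b - snd a $ j" for j
  proof (rule antisym)
    obtain l where l: "(l, j) \<in> finite_entries V" "potential ?z j = weight V (l, j) - ?z $ l"
      by (rule potential_attained)
    then show "b - snd a $ j \<le> potential ?z j" using low[OF l(1)] by (simp add: inner_vertex)
    obtain i where "(i, j) \<in> cell_graph V C" using cov by blast
    then show "potential ?z j \<le> b - snd a $ j"
      using potential_le[of i j ?z] by (auto simp: G inner_vertex)
  qed
  have "cell_graph V C = covector_graph V ?z"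
    unfolding G covector_graph_eq_potential pot by (auto simp: inner_vertex)
  then show ?thesis by (rule that)
qed

lemma column_covering_cellI:
  "C \<in> matrix_subdivision V \<Longrightarrow> cell_graph V C = covector_graph V z \<Longrightarrow> C \<in> column_covering_cells V"
  by (simp add: column_covering_cells_def covector_graph_covers_columns)

lemma interior_cells_eq:
  "interior_cells V = {C \<in> column_covering_cells V. \<forall>i. \<exists>j. (i, j) \<in> cell_graph V C}"
proof -
  have "C \<subseteq> rel_frontier (convex hull (range vertex)) \<longleftrightarrow>
      \<not> ((\<forall>i. \<exists>j. (i, j) \<in> cell_graph V C) \<and> (\<forall>j. \<exists>i. (i, j) \<in> cell_graph V C))"
    if "C \<in> matrix_subdivision V" for C
  proof -
    have C: "C \<in> regular_subdivision vertex (weight V) (finite_entries V)"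
      using that by (simp add: matrix_subdivision_def)
    have "cell_graph V C \<noteq> {}"
      unfolding cell_graph_def by (rule cell_indices_exposed[OF finite_class.finite C])
    moreover have "C = convex hull (vertex ` cell_graph V C)"
      using cell_eq_convex_hull[OF finite_class.finite C] unfolding cell_graph_def .
    ultimately show ?thesis using convex_hull_vertices_subset_rel_frontier_iff by metis
  qed
  then show ?thesis unfolding interior_cells_def column_covering_cells_def by blast
qed

text \<open>Both sides amount to inclusion of graphs. Recovering it from the covector cells relies
  on the graphs being covector graphs of points.\<close>

lemma covector_cell_cell_graph_subset_iff:
  assumes "C \<in> column_covering_cells V" "D \<in> column_covering_cells V"
  shows "C \<subseteq> D \<longleftrightarrow> covector_cell V (cell_graph V D) \<subseteq> covector_cell V (cell_graph V C)"
proof -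
  have "C \<subseteq> D \<longleftrightarrow> cell_graph V C \<subseteq> cell_graph V D"
    using assms unfolding cell_graph_def column_covering_cells_def matrix_subdivision_def
    by (intro cell_subset_iff) auto
  then show ?thesis
    using column_covering_cell_graph[OF assms(1)] column_covering_cell_graph[OF assms(2)]
      covector_cell_subset_iff by metis
qed

text \<open>Reversing inclusions in both directions already yields injectivity by antisymmetry, so
  each duality reduces to computing an image.\<close>

lemma dual_via_covector_cell:
  assumes sub: "\<C> \<subseteq> column_covering_cells V"
    and img: "(\<lambda>C. covector_cell V (cell_graph V C)) ` \<C> = \<D>"
  shows "dual_via (\<lambda>C. covector_cell V (cell_graph V C)) \<C> \<D>"
proof -
  have "inj_on (\<lambda>C. covector_cell V (cell_graph V C)) \<C>"
    using covector_cell_cell_graph_subset_iff sub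
    by (intro inj_onI subset_antisym) (simp_all add: subset_iff[of \<C>])
  then show ?thesis
    using covector_cell_cell_graph_subset_iff sub img
    unfolding dual_via_def bij_betw_def by blast
qed

lemma image_column_covering_cells:
  "(\<lambda>C. covector_cell V (cell_graph V C)) ` column_covering_cells V = covector_decomposition V"
  unfolding covector_decomposition_eq
proof (intro equalityI subsetI)
  fix A assume "A \<in> (\<lambda>C. covector_cell V (cell_graph V C)) ` column_covering_cells V"
  then show "A \<in> range (\<lambda>z. covector_cell V (covector_graph V z))"
    by (auto elim: column_covering_cell_graph)
next
  fix A assume "A \<in> range (\<lambda>z. covector_cell V (covector_graph V z))"
  then obtain z where z: "A = covector_cell V (covector_graph V z)" by blast
  obtain C where C: "C \<in> matrix_subdivision V" "cell_graph V C = covector_graph V z"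
    by (rule covector_graph_is_cell_graph)
  show "A \<in> (\<lambda>C. covector_cell V (cell_graph V C)) ` column_covering_cells V"
    using z C(2) column_covering_cellI[OF C] by (intro image_eqI[of _ _ C]) simp_all
qed

lemma image_interior_cells:
  "(\<lambda>C. covector_cell V (cell_graph V C)) ` interior_cells V = tcone_covector_decomposition V"
proof (intro equalityI subsetI)
  fix A assume "A \<in> (\<lambda>C. covector_cell V (cell_graph V C)) ` interior_cells V"
  then show "A \<in> tcone_covector_decomposition V"
    unfolding interior_cells_eq
    using column_covering_cell_graph covector_cell_in_tcone_decomposition_iff by auto metis
next
  fix A assume A: "A \<in> tcone_covector_decomposition V"
  then obtain z where z: "A = covector_cell V (covector_graph V z)"
    unfolding tcone_covector_decomposition_def covector_decomposition_eq by auto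
  obtain C where C: "C \<in> matrix_subdivision V" "cell_graph V C = covector_graph V z"
    by (rule covector_graph_is_cell_graph)
  show "A \<in> (\<lambda>C. covector_cell V (cell_graph V C)) ` interior_cells V"
    unfolding interior_cells_eq
    using A z C(2) column_covering_cellI[OF C] covector_cell_in_tcone_decomposition_iff
    by (intro image_eqI[of _ _ C]) simp_all
qed

end

theorem corollary34:
  fixes V :: "ereal^('n::finite)^('d::finite)"
  assumes "\<And>i j. V $ i $ j \<noteq> -\<infinity>"
    and "\<And>j. \<exists>i. V $ i $ j \<noteq> \<infinity>"
  shows "dual_via (\<lambda>C. covector_cell V (cell_graph V C))
           (column_covering_cells V) (covector_decomposition V) \<and>
         interior_cells V \<subseteq> column_covering_cells V \<and>
         dual_via (\<lambda>C. covector_cell V (cell_graph V C))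
           (interior_cells V) (tcone_covector_decomposition V)"
proof -
  have "interior_cells V \<subseteq> column_covering_cells V"
    using interior_cells_eq[OF assms] by blast
  then show ?thesis
    using dual_via_covector_cell[OF assms] image_column_covering_cells[OF assms]
      image_interior_cells[OF assms] by blast
qed

end
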